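(* Let $n\ge 1$ and let $\mathbf{v}$ be an $\mathbf{x}\mathbf{y}$-word of length $n-1$. Then the $f$-polynomial of the descent polytope $\mathrm{DP}_{\mathbf{v}}$ is given by $$F_{\mathbf{v}}(t) = 1 + \sum_{T\subseteq [n-1]} \left(\frac{t+1}{t}\right)^{\kappa(\mathbf{v}^{T})}\cdot t^{|T|+1}.$$
   Context: Write $[m]=\{1,\dots,m\}$ (with $[0]=\varnothing$). An $\mathbf{x}\mathbf{y}$-word is a finite (possibly empty) word in the two letters $\mathbf{x},\mathbf{y}$; the empty word is denoted $1$. Descent polytope: for an $\mathbf{x}\mathbf{y}$-word $\mathbf{v}=\mathbf{v}_1\cdots\mathbf{v}_{n-1}$ of length $n-1$ ($n\ge 1$), $\mathrm{DP}_{\mathbf{v}}\subset\mathbb{R}^n$ is the set of points $(x_1,\dots,x_n)$ with $0\le x_i\le 1$ for all $i$, and, for $1\le i\le n-1$, $x_i\le x_{i+1}$ if $\mathbf{v}_i=\mathbf{x}$ and $x_i\ge x_{i+1}$ if $\mathbf{v}_i=\mathbf{y}$. It is an $n$-dimensional polytope. $f$-polynomial: $F_{\mathbf{v}}(t)=\sum_{\mathcal F} t^{\dim\mathcal F}$, the sum being over all nonempty faces $\mathcal F$ of $\mathrm{DP}_{\mathbf{v}}$, including $\mathrm{DP}_{\mathbf{v}}$ itself. For an $\mathbf{x}\mathbf{y}$-word $\mathbf{w}=\mathbf{w}_1\cdots\mathbf{w}_m$, set $\kappa(\mathbf{w})=2+|\{i: 1\le i\le m-1,\ \mathbf{w}_i\ne\mathbf{w}_{i+1}\}|$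 if $\mathbf{w}\neq 1$, and $\kappa(1)=1$. For $T=\{j_1<j_2<\cdots<j_k\}\subseteq[n-1]$, $\mathbf{v}^T=\mathbf{v}_{j_1}\mathbf{v}_{j_2}\cdots\mathbf{v}_{j_k}$ (so $\mathbf{v}^{\varnothing}=1$). *)

theory Defs
  imports
    "HOL-Analysis.Analysis"
    "HOL-Computational_Algebra.Computational_Algebra"
begin

datatype letter = Lx | Ly

type_synonym xyword = "letter list"

text \<open>
  The space \<open>\<real>\<^sup>n\<close> is \<open>real ^ 'n\<close> with \<open>CARD('n) = n\<close>. Since a finite index type carries no
  canonical numbering, \<open>e\<close> numbers the coordinates: \<open>x $ e i\<close> is the coordinate \<open>x\<^sub>i\<close>,
  for \<open>1 \<le> i \<le> n\<close>. Letters of words are also numbered from 1, so \<open>v\<^sub>i\<close> is \<open>v ! (i - 1)\<close>.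
\<close>

definition descent_polytope :: "(nat \<Rightarrow> 'n::finite) \<Rightarrow> xyword \<Rightarrow> (real ^ 'n) set" where
  "descent_polytope e v =
     {x. (\<forall>i\<in>{1..length v + 1}. 0 \<le> x $ e i \<and> x $ e i \<le> 1) \<and>
         (\<forall>i\<in>{1..length v}.
            (v ! (i - 1) = Lx \<longrightarrow> x $ e i \<le> x $ e (i + 1)) \<and>
            (v ! (i - 1) = Ly \<longrightarrow> x $ e i \<ge> x $ e (i + 1)))}"

text \<open>
  The sum below is meaningful for polytopes, which have finitely many faces. A convex set is a
  face of itself in the sense of \<open>face_of\<close>, and \<open>aff_dim\<close> is nonnegative on
  nonempty sets, so \<open>nat\<close> does not truncate.
\<close>

definition f_polynomial :: "'a::euclidean_space set \<Rightarrow> int poly" where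
  "f_polynomial P = (\<Sum>F | F face_of P \<and> F \<noteq> {}. monom 1 (nat (aff_dim F)))"

definition kappa :: "xyword \<Rightarrow> nat" where
  "kappa w =
     (if w = [] then 1
      else 2 + card {i. 1 \<le> i \<and> i \<le> length w - 1 \<and> w ! (i - 1) \<noteq> w ! i})"

definition subword :: "xyword \<Rightarrow> nat set \<Rightarrow> xyword" where
  "subword v T = map (\<lambda>j. v ! (j - 1)) (sorted_list_of_set T)"

text \<open>The indeterminate \<open>t\<close>, as an element of the field of fractions of \<open>\<int>[t]\<close>.\<close>

abbreviation indet :: "int poly fract" where
  "indet \<equiv> to_fract [:0, 1:]"

end

theory Submission
  imports Defs
begin

text \<open>
  A nonempty face of a polytope consists of the points that satisfy with equality at least the
  constraints active at a point of its relative interior. For a descent polytope the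
  possible constraints are \<open>x\<^sub>i = 0\<close>, \<open>x\<^sub>i = 1\<close> and \<open>x\<^sub>i = x\<^sub>i\<^sub>+\<^sub>1\<close>. Which of them hold at a point is recorded
  by a pattern: a list with one entry per coordinate, saying whether the coordinate is \<open>0\<close>, is \<open>1\<close>,
  repeats the previous interior value, or has a fresh interior value. Since the coordinates form
  a path, a list is the pattern of some point as soon as each pair of neighbouring entries is
  allowed by the letter between them. The directions within a face are free
  at the fresh entries and determined by them elsewhere, so the dimension is the number
  of fresh entries. Hence the \<open>f\<close>-polynomial is a sum over admissible patterns
  (\<open>f_polynomial_descent_polytope\<close>), which a transfer matrix computes letter by letter.

  Let \<open>W\<close> be this sum, and for each letter \<open>c\<close> let \<open>w\<^sub>c\<close> be its part from patterns whose last
  coordinate is at the end of \<open>[0, 1]\<close> towards which \<open>c\<close> moves (\<open>1\<close> for \<open>Lx\<close>, \<open>0\<close> for \<open>Ly\<close>). Appending \<open>c\<close> replaces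
  \<open>w\<^sub>c\<close> by \<open>W\<close>, keeps the other part, and replaces \<open>W\<close> by \<open>W + (t + 1) * (W - w\<^sub>c)\<close>. On the other side,
  let \<open>G\<close> be the sum over all subwords and \<open>X\<^sub>c\<close> its part from subwords ending in \<open>c\<close>. Appending \<open>c\<close>
  replaces \<open>X\<^sub>c\<close> by \<open>(t + 1) * G\<close>, keeps the other part, and replaces \<open>G\<close> by \<open>G + (t + 1) * G - X\<^sub>c\<close>. So the
  relations \<open>W = 1 + G\<close> and \<open>X\<^sub>c = (t + 1) * (w\<^sub>c - 1)\<close>, true for the empty word, persist
  (\<open>pattern_sum_eq_subword_sum\<close>).
\<close>

unbundle no fps_syntax

section \<open>Faces of a polyhedron and their active constraints\<close>

definition half_spaces :: "('a::euclidean_space \<times> real) set \<Rightarrow> 'a set" where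
  "half_spaces C = {x. \<forall>(a, b)\<in>C. a \<bullet> x \<le> b}"

definition tight :: "('a::euclidean_space \<times> real) set \<Rightarrow> 'a \<Rightarrow> ('a \<times> real) set" where
  "tight C x = {(a, b)\<in>C. a \<bullet> x = b}"

definition tight_face :: "('a::euclidean_space \<times> real) set \<Rightarrow> 'a \<Rightarrow> 'a set" where
  "tight_face C x = {y \<in> half_spaces C. tight C x \<subseteq> tight C y}"

lemma tight_subset_iff:
  "tight C x \<subseteq> tight C y \<longleftrightarrow> (\<forall>(a, b)\<in>C. a \<bullet> x = b \<longrightarrow> a \<bullet> y = b)"
  by (auto simp: tight_def)

lemma convex_half_spaces: "convex (half_spaces C)"
proof -
  have "half_spaces C = (\<Inter>(a, b)\<in>C. {x. a \<bullet> x \<le> b})"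
    by (auto simp: half_spaces_def)
  then show ?thesis
    by (auto intro!: convex_INT simp: convex_halfspace_le)
qed

lemma open_segment_inner_eq:
  fixes a :: "'a::euclidean_space"
  assumes "z \<in> open_segment x y" "a \<bullet> x \<le> b" "a \<bullet> y \<le> b" "a \<bullet> z = b"
  shows "a \<bullet> x = b"
proof -
  obtain u where u: "0 < u" "u < 1" "z = (1 - u) *\<^sub>R x + u *\<^sub>R y"
    using assms(1) by (auto simp: in_segment)
  have "(1 - u) * (b - a \<bullet> x) + u * (b - a \<bullet> y) = 0"
    using assms(4) u(3) by (simp add: algebra_simps)
  moreover have "0 \<le> (1 - u) * (b - a \<bullet> x)" "0 \<le> u * (b - a \<bullet> y)"
    using u assms by auto
  ultimately have "(1 - u) * (b - a \<bullet> x) = 0"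
    by linarith
  then show ?thesis
    using u by simp
qed

text \<open>
  A constraint that is active inside a segment of the polyhedron is active on the whole segment.
\<close>

lemma tight_face_face_of: "tight_face C x face_of half_spaces C"
proof -
  have "convex (tight_face C x)"
  proof -
    have "tight_face C x = half_spaces C \<inter> (\<Inter>(a, b)\<in>tight C x. {y. a \<bullet> y = b})"
      by (auto simp: tight_face_def tight_def)
    then show ?thesis
      by (auto intro!: convex_INT convex_Int convex_half_spaces simp: convex_hyperplane)
  qed
  moreover have "y \<in> tight_face C x"
    if "y \<in> half_spaces C" "y' \<in> half_spaces C" "z \<in> tight_face C x" "z \<in> open_segment y y'"
    for y y' z
    unfolding tight_face_def tight_subset_iff
  proof (clarify, intro conjI that(1) ballI, clarify)
    fix a assume "(a, a \<bullet> x) \<in> C"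
    then show "a \<bullet> y = a \<bullet> x"
      using that
      by (intro open_segment_inner_eq[of z y y']) (auto simp: tight_face_def tight_subset_iff half_spaces_def)
  qed
  ultimately show ?thesis
    unfolding face_of_def
    by (metis (no_types, lifting) mem_Collect_eq open_segment_commute subsetI tight_face_def)
qed

text \<open>
  A motion in a direction that keeps the active constraints active can violate a constraint only
  after it has used up the slack of one of the finitely many inactive ones.
\<close>

lemma move_along_tight_direction:
  assumes "finite C" "x \<in> half_spaces C" "tight C x \<subseteq> tight C y"
  obtains \<epsilon> where "\<epsilon> > 0" "\<And>\<delta>. \<bar>\<delta>\<bar> \<le> \<epsilon> \<Longrightarrow> x + \<delta> *\<^sub>R (y - x) \<in> half_spaces C"
proof -
  have "\<forall>\<^sub>F \<delta> in nhds (0::real). case c of (a, b) \<Rightarrow> a \<bullet> (x + \<delta> *\<^sub>R (y - x)) \<le> b" if c: "c \<in> C" for c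
  proof -
    obtain a b where ab: "c = (a, b)" by force
    have le: "a \<bullet> x \<le> b"
      using assms(2) c ab by (auto simp: half_spaces_def)
    show ?thesis
    proof (cases "a \<bullet> x = b")
      case True
      then have "a \<bullet> y = b"
        using assms(3) c ab by (auto simp: tight_subset_iff)
      with True show ?thesis
        by (simp add: ab inner_add_right inner_diff_right)
    next
      case False
      have "((\<lambda>\<delta>. a \<bullet> (x + \<delta> *\<^sub>R (y - x))) \<longlongrightarrow> a \<bullet> (x + 0 *\<^sub>R (y - x))) (nhds 0)"
        by (intro tendsto_intros filterlim_ident)
      then have "\<forall>\<^sub>F \<delta> in nhds 0. a \<bullet> (x + \<delta> *\<^sub>R (y - x)) < b"
        by (rule order_tendstoD) (use False le in auto)
      then show ?thesis
        by (auto simp: ab elim: eventually_mono)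
    qed
  qed
  then have "\<forall>\<^sub>F \<delta> in nhds (0::real). \<forall>c\<in>C. case c of (a, b) \<Rightarrow> a \<bullet> (x + \<delta> *\<^sub>R (y - x)) \<le> b"
    by (intro eventually_ball_finite assms(1)) auto
  then obtain d where d: "d > 0"
    and "\<And>\<delta>. dist \<delta> 0 < d \<Longrightarrow> x + \<delta> *\<^sub>R (y - x) \<in> half_spaces C"
    by (auto simp: eventually_nhds_metric half_spaces_def)
  then show ?thesis
    by (intro that[of "d / 2"]) auto
qed

text \<open>
  Take \<open>x\<close> in the relative interior of \<open>F\<close>. Each segment from a point of \<open>F\<close> to \<open>x\<close> can be
  prolonged beyond \<open>x\<close> inside \<open>F\<close>, so whatever is active at \<open>x\<close> is active on \<open>F\<close>.
  Conversely, a segment to \<open>x\<close> from a point \<open>y\<close> with at least the same active constraints can be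
  prolonged inside the polyhedron, and the face property pulls \<open>y\<close> into \<open>F\<close>.
\<close>

lemma nonempty_face_is_tight_face:
  assumes "finite C" "F face_of half_spaces C" "F \<noteq> {}"
  obtains x where "x \<in> half_spaces C" "F = tight_face C x"
proof -
  have "convex F"
    using assms(2) face_of_imp_convex by blast
  then obtain x where x: "x \<in> rel_interior F"
    using assms(3) rel_interior_eq_empty by blast
  have FP: "F \<subseteq> half_spaces C"
    using assms(2) face_of_imp_subset by blast
  have xF: "x \<in> F"
    using x rel_interior_subset by blast
  have "F = tight_face C x"
  proof (intro equalityI subsetI)
    fix y assume y: "y \<in> F"
    obtain u where u: "u > 1" "(1 - u) *\<^sub>R y + u *\<^sub>R x \<in> F"
      using x y \<open>convex F\<close> convex_rel_interior_iff[of F x] assms(3) by blast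
    define z where "z = (1 - u) *\<^sub>R y + u *\<^sub>R x"
    have "a \<bullet> y = b" if "(a, b) \<in> C" "a \<bullet> x = b" for a b
    proof -
      have "a \<bullet> y \<le> b" "a \<bullet> z \<le> b"
        using that FP y u(2) by (auto simp: half_spaces_def z_def)
      moreover have "a \<bullet> z - b = (u - 1) * (b - a \<bullet> y)"
        using that(2) by (simp add: z_def inner_add_right algebra_simps)
      ultimately have "(u - 1) * (b - a \<bullet> y) \<le> 0"
        by simp
      then have "b \<le> a \<bullet> y"
        using u(1) by (simp add: mult_le_0_iff)
      with \<open>a \<bullet> y \<le> b\<close> show ?thesis by simp
    qed
    then show "y \<in> tight_face C x"
      using y FP by (auto simp: tight_face_def tight_subset_iff)
  next
    fix y assume y: "y \<in> tight_face C x"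
    show "y \<in> F"
    proof (cases "y = x")
      case False
      obtain \<epsilon> where e: "\<epsilon> > 0" "\<And>\<delta>. \<bar>\<delta>\<bar> \<le> \<epsilon> \<Longrightarrow> x + \<delta> *\<^sub>R (y - x) \<in> half_spaces C"
        using move_along_tight_direction[OF assms(1)] xF FP y
        by (metis (no_types, lifting) mem_Collect_eq subsetD tight_face_def)
      define z where "z = x + (- \<epsilon>) *\<^sub>R (y - x)"
      have "z \<in> half_spaces C"
        unfolding z_def by (rule e) (use e(1) in auto)
      moreover have "x \<in> open_segment y z"
        unfolding in_segment
      proof (intro conjI exI[of _ "1 / (1 + \<epsilon>)"])
        have "z - y = (1 + \<epsilon>) *\<^sub>R (x - y)"
          by (simp add: z_def algebra_simps)
        then show "y \<noteq> z"
          using False e(1) by auto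
        have "(1 - 1 / (1 + \<epsilon>)) *\<^sub>R y + (1 / (1 + \<epsilon>)) *\<^sub>R z = y + (1 / (1 + \<epsilon>)) *\<^sub>R (z - y)"
          by (simp add: algebra_simps)
        also have "\<dots> = x"
          unfolding \<open>z - y = _\<close> using e(1) by simp
        finally show "x = (1 - 1 / (1 + \<epsilon>)) *\<^sub>R y + (1 / (1 + \<epsilon>)) *\<^sub>R z" ..
      qed (use e(1) in auto)
      moreover have "y \<in> half_spaces C"
        using y by (simp add: tight_face_def)
      ultimately show ?thesis
        using assms(2) xF unfolding face_of_def by blast
    qed (use xF in simp)
  qed
  then show ?thesis
    using that xF FP by blast
qed

lemma nonempty_faces_eq:
  assumes "finite C"
  shows "{F. F face_of half_spaces C \<and> F \<noteq> {}} = tight_face C ` half_spaces C"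
proof -
  have "x \<in> tight_face C x" if "x \<in> half_spaces C" for x
    using that by (simp add: tight_face_def)
  then show ?thesis
    using tight_face_face_of nonempty_face_is_tight_face[OF assms] by blast
qed

lemma tight_face_eq_iff:
  assumes "x \<in> half_spaces C" "y \<in> half_spaces C"
  shows "tight_face C x = tight_face C y \<longleftrightarrow> tight C x = tight C y"
  using assms by (auto simp: tight_face_def)

text \<open>
  The directions that keep the constraints active at \<open>x\<close> active form a linear space, and a short
  step from \<open>x\<close> along any of them stays in the face; so they are the directions of its affine hull.
\<close>

lemma aff_dim_tight_face:
  assumes "finite C" "x \<in> half_spaces C"
  shows "aff_dim (tight_face C x) = int (dim {d. \<forall>(a, b)\<in>C. a \<bullet> x = b \<longrightarrow> a \<bullet> d = 0})"
proof -
  define D where "D = {d. \<forall>(a, b)\<in>C. a \<bullet> x = b \<longrightarrow> a \<bullet> d = 0}"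
  have x: "x \<in> tight_face C x"
    using assms(2) by (simp add: tight_face_def)
  have sub: "(\<lambda>y. - x + y) ` tight_face C x \<subseteq> D"
    by (auto simp: tight_face_def tight_subset_iff D_def inner_add_right inner_diff_right)
  have "D \<subseteq> span ((\<lambda>y. - x + y) ` tight_face C x)"
  proof
    fix d assume d: "d \<in> D"
    have t: "tight C x \<subseteq> tight C (x + r *\<^sub>R d)" for r
      using d by (auto simp: tight_subset_iff D_def inner_add_right)
    obtain \<epsilon> where e: "\<epsilon> > 0" "\<And>\<delta>. \<bar>\<delta>\<bar> \<le> \<epsilon> \<Longrightarrow> x + \<delta> *\<^sub>R ((x + 1 *\<^sub>R d) - x) \<in> half_spaces C"
      using move_along_tight_direction[OF assms t] by metis
    have "x + \<epsilon> *\<^sub>R d \<in> tight_face C x"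
      using e(2)[of \<epsilon>] e(1) t by (auto simp: tight_face_def)
    then have "- x + (x + \<epsilon> *\<^sub>R d) \<in> (\<lambda>y. - x + y) ` tight_face C x"
      by blast
    then have "(1 / \<epsilon>) *\<^sub>R (- x + (x + \<epsilon> *\<^sub>R d)) \<in> span ((\<lambda>y. - x + y) ` tight_face C x)"
      by (intro span_scale span_base)
    then show "d \<in> span ((\<lambda>y. - x + y) ` tight_face C x)"
      using e(1) by simp
  qed
  then have "dim ((\<lambda>y. - x + y) ` tight_face C x) = dim D"
    using sub by (metis dim_span dim_subset order_antisym)
  moreover have "aff_dim (tight_face C x) = int (dim ((\<lambda>y. - x + y) ` tight_face C x))"
    by (rule aff_dim_eq_dim) (use x in \<open>simp add: hull_inc\<close>)
  ultimately show ?thesis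
    by (simp add: D_def)
qed

section \<open>Face patterns and their generating function\<close>

text \<open>
  A point of the polytope is read from left to right. Its pattern records at each index whether
  the coordinate is \<open>0\<close>, is \<open>1\<close>, or lies strictly between; in the last case \<open>Repeat\<close> says that it
  equals the previous coordinate and \<open>Fresh\<close> that it does not, or that it is the
  first coordinate. Each \<open>Fresh\<close> entry begins a new
  block of equal coordinates that can move freely within the face.
\<close>

datatype position = AtZero | AtOne | Fresh | Repeat

text \<open>
  The end of the interval \<open>[0, 1]\<close> towards which the letter moves the coordinates; a sequence that
  has reached this end cannot leave it by a step with this letter.
\<close>

fun target_end :: "letter \<Rightarrow> position" where
  "target_end Lx = AtOne"
| "target_end Ly = AtZero"

text \<open>
  The entry \<open>0\<close> or \<open>1\<close> is always available if the letter moves towards it; the opposite end can only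
  be repeated. A \<open>Fresh\<close> value needs room in front of it, a \<open>Repeat\<close> needs a previous value
  strictly inside the interval.
\<close>

fun step_allowed :: "letter \<Rightarrow> position \<Rightarrow> position \<Rightarrow> bool" where
  "step_allowed c p Repeat \<longleftrightarrow> p = Fresh \<or> p = Repeat"
| "step_allowed c p Fresh \<longleftrightarrow> p \<noteq> target_end c"
| "step_allowed c p q \<longleftrightarrow> q = target_end c \<or> p = q"

definition admissible :: "xyword \<Rightarrow> position list \<Rightarrow> bool" where
  "admissible v s \<longleftrightarrow> length s = length v + 1 \<and> s ! 0 \<noteq> Repeat \<and>
     (\<forall>i<length v. step_allowed (v ! i) (s ! i) (s ! (i + 1)))"

lemma UNIV_position: "(UNIV :: position set) = {AtZero, AtOne, Fresh, Repeat}"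
  using position.exhaust by blast

instance position :: finite
  by standard (simp add: UNIV_position)

lemma finite_admissible: "finite {s. admissible v s}"
  by (rule finite_subset[OF _ finite_lists_length_eq[of UNIV "length v + 1"]])
     (auto simp: admissible_def)

lemma admissible_Nil_iff: "admissible [] s \<longleftrightarrow> s \<in> {[AtZero], [AtOne], [Fresh]}"
proof (cases "\<exists>q. s = [q]")
  case True
  then obtain q where "s = [q]" by blast
  then show ?thesis by (cases q) (auto simp: admissible_def)
next
  case False
  then show ?thesis by (auto simp: admissible_def length_Suc_conv)
qed

lemma admissible_snoc_iff:
  "admissible (v @ [c]) (s @ [q]) \<longleftrightarrow> admissible v s \<and> step_allowed c (last s) q"
proof (cases "length s = length v + 1")
  case True
  then have last: "last s = s ! length v"
    by (cases s rule: rev_cases) (auto simp: nth_append)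
  have "(\<forall>i<length v. step_allowed ((v @ [c]) ! i) ((s @ [q]) ! i) ((s @ [q]) ! (i + 1))) \<longleftrightarrow>
      (\<forall>i<length v. step_allowed (v ! i) (s ! i) (s ! (i + 1)))"
    using True by (simp add: nth_append cong: imp_cong)
  then show ?thesis
    using True by (simp add: admissible_def last All_less_Suc nth_append conj_ac)
qed (auto simp: admissible_def)

definition pattern_sum_at :: "'a::field \<Rightarrow> xyword \<Rightarrow> position \<Rightarrow> 'a" where
  "pattern_sum_at t v q = (\<Sum>s | admissible v s \<and> last s = q. t ^ count_list s Fresh)"

definition pattern_sum :: "'a::field \<Rightarrow> xyword \<Rightarrow> 'a" where
  "pattern_sum t v = (\<Sum>s | admissible v s. t ^ count_list s Fresh)"

lemma pattern_sum_by_last: "pattern_sum t v = (\<Sum>q\<in>UNIV. pattern_sum_at t v q)"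
  unfolding pattern_sum_def pattern_sum_at_def
  using sum.group[of "{s. admissible v s}" UNIV last "\<lambda>s. t ^ count_list s Fresh"]
  by (simp add: finite_admissible)

lemma pattern_sum_at_snoc:
  "pattern_sum_at t (v @ [c]) q =
    (if q = Fresh then t else 1) * (\<Sum>p | step_allowed c p q. pattern_sum_at t v p)"
proof -
  have eq: "{s. admissible (v @ [c]) s \<and> last s = q} =
        (\<lambda>s. s @ [q]) ` {s. admissible v s \<and> step_allowed c (last s) q}" (is "?L = ?R")
  proof (intro equalityI subsetI)
    fix s assume s: "s \<in> ?L"
    then have "s \<noteq> []"
      by (auto simp: admissible_def)
    then have "s = butlast s @ [q]"
      using s by (metis (mono_tags, lifting) append_butlast_last_id mem_Collect_eq)
    moreover from this s have "admissible v (butlast s) \<and> step_allowed c (last (butlast s)) q"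
      by (metis (mono_tags, lifting) admissible_snoc_iff mem_Collect_eq)
    ultimately show "s \<in> ?R"
      by blast
  qed (auto simp: admissible_snoc_iff)
  have "pattern_sum_at t (v @ [c]) q =
      (\<Sum>s | admissible v s \<and> step_allowed c (last s) q. t ^ count_list (s @ [q]) Fresh)"
    unfolding pattern_sum_at_def eq by (subst sum.reindex) (auto simp: inj_on_def)
  also have "\<dots> = (if q = Fresh then t else 1) *
      (\<Sum>s | admissible v s \<and> step_allowed c (last s) q. t ^ count_list s Fresh)"
    by (auto simp: sum_distrib_left)
  also have "(\<Sum>s | admissible v s \<and> step_allowed c (last s) q. t ^ count_list s Fresh) =
      (\<Sum>p | step_allowed c p q. \<Sum>s | s \<in> {s. admissible v s \<and> step_allowed c (last s) q} \<and> last s = p.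
         t ^ count_list s Fresh)"
    by (rule sum.group[symmetric])
       (auto intro: finite_subset[OF _ finite_admissible] finite_subset[OF _ finite])
  also have "\<dots> = (\<Sum>p | step_allowed c p q. pattern_sum_at t v p)"
    unfolding pattern_sum_at_def by (intro sum.cong) (auto intro!: sum.cong)
  finally show ?thesis .
qed

lemma sum_position:
  "(\<Sum>p | P p. f p) =
    (if P AtZero then f AtZero else 0) + (if P AtOne then f AtOne else 0) +
    (if P Fresh then f Fresh else 0) + (if P Repeat then f Repeat else (0::'a::comm_monoid_add))"
  for P :: "position \<Rightarrow> bool"
proof -
  have "(\<Sum>p | P p. f p) = (\<Sum>p\<in>UNIV. if P p then f p else 0)"
    by (simp add: sum.inter_filter[symmetric])
  then show ?thesis
    by (simp add: UNIV_position add.assoc)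
qed

lemma pattern_sum_split:
  "pattern_sum t v = pattern_sum_at t v AtZero + pattern_sum_at t v AtOne +
    pattern_sum_at t v Fresh + pattern_sum_at t v Repeat"
  unfolding pattern_sum_by_last by (simp add: UNIV_position add.assoc)

text \<open>
  Every pattern can be continued to the end towards which the new letter moves, whereas the
  opposite end is reached only by repeating it. So each of the two pattern sums at the ends
  becomes the whole previous sum or stays unchanged, like a sum over subwords with prescribed
  last letter.
\<close>

lemma pattern_sum_at_snoc_end: "pattern_sum_at t (v @ [c]) (target_end c) = pattern_sum t v"
  by (cases c) (simp_all add: pattern_sum_at_snoc pattern_sum_by_last)

lemma pattern_sum_at_snoc_other_end:
  "d \<noteq> c \<Longrightarrow> pattern_sum_at t (v @ [c]) (target_end d) = pattern_sum_at t v (target_end d)"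
  by (cases c; cases d) (simp_all add: pattern_sum_at_snoc sum_position)

lemma pattern_sum_snoc:
  "pattern_sum t (v @ [c]) = pattern_sum t v + (t + 1) * (pattern_sum t v - pattern_sum_at t v (target_end c))"
  by (cases c) (simp_all add: pattern_sum_split pattern_sum_at_snoc sum_position UNIV_position algebra_simps)

lemma pattern_sum_at_Nil_end: "pattern_sum_at t [] (target_end c) = 1"
proof -
  have "{s. admissible [] s \<and> last s = target_end c} = {[target_end c]}"
    by (cases c) (auto simp: admissible_Nil_iff)
  then show ?thesis
    by (cases c) (auto simp: pattern_sum_at_def)
qed

lemma pattern_sum_Nil: "pattern_sum t [] = t + 2"
proof -
  have "{s. admissible [] s} = {[AtZero], [AtOne], [Fresh]}"
    by (auto simp: admissible_Nil_iff)
  then show ?thesis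
    by (simp add: pattern_sum_def)
qed

section \<open>Sums over the subwords of a word\<close>

lemma subword_empty: "subword v {} = []"
  by (simp add: subword_def)

lemma length_subword: "length (subword v T) = card T"
  by (simp add: subword_def)

lemma subword_snoc_old:
  assumes "T \<subseteq> {1..length v}"
  shows "subword (v @ [c]) T = subword v T"
  unfolding subword_def
proof (rule map_cong[OF refl])
  fix j assume "j \<in> set (sorted_list_of_set T)"
  then have "j \<in> {1..length v}"
    using assms finite_subset[OF assms] by auto
  then show "(v @ [c]) ! (j - 1) = v ! (j - 1)"
    by (auto simp: nth_append)
qed

lemma subword_snoc_new:
  assumes "T \<subseteq> {1..length v}"
  shows "subword (v @ [c]) (insert (Suc (length v)) T) = subword v T @ [c]"
proof -
  have fin: "finite T"
    using assms finite_subset by blast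
  have "sorted_list_of_set (insert (Suc (length v)) T) = sorted_list_of_set T @ [Suc (length v)]"
  proof (rule strict_sorted_equal)
    show "sorted_wrt (<) (sorted_list_of_set T @ [Suc (length v)])"
      using assms fin by (auto simp: sorted_wrt_append less_Suc_eq_le)
  qed (use fin in \<open>auto simp del: sorted_list_of_set_insert_remove\<close>)
  then show ?thesis
    using subword_snoc_old[OF assms, of c] by (simp add: subword_def)
qed

text \<open>
  A subset of \<open>{1..m + 1}\<close> either misses \<open>m + 1\<close>, and then the new letter is not selected, or
  contains it, and then the new letter is appended to the old subword.
\<close>

lemma sum_subwords_snoc:
  fixes f :: "xyword \<Rightarrow> 'a::comm_monoid_add"
  shows "(\<Sum>T\<in>Pow {1..length (v @ [c])}. f (subword (v @ [c]) T)) =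
    (\<Sum>T\<in>Pow {1..length v}. f (subword v T)) + (\<Sum>T\<in>Pow {1..length v}. f (subword v T @ [c]))"
proof -
  let ?A = "Pow {1..length v}" and ?m = "Suc (length v)"
  have P: "Pow {1..length (v @ [c])} = ?A \<union> insert ?m ` ?A"
    by (simp add: atLeastAtMostSuc_conv Pow_insert)
  have inj: "inj_on (insert ?m) ?A"
  proof (rule inj_onI)
    fix S T assume "S \<in> ?A" "T \<in> ?A" "insert ?m S = insert ?m T"
    moreover have "?m \<notin> S" "?m \<notin> T"
      using calculation by auto
    ultimately show "S = T"
      by (metis Diff_insert_absorb)
  qed
  have "(\<Sum>T\<in>Pow {1..length (v @ [c])}. f (subword (v @ [c]) T)) =
      (\<Sum>T\<in>?A. f (subword (v @ [c]) T)) + (\<Sum>T\<in>?A. f (subword (v @ [c]) (insert ?m T)))"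
    unfolding P 
    by (subst sum.union_disjoint) (auto simp: sum.reindex[OF inj, unfolded comp_def, simplified])
  also have "(\<Sum>T\<in>?A. f (subword (v @ [c]) T)) = (\<Sum>T\<in>?A. f (subword v T))"
    by (intro sum.cong) (auto simp: subword_snoc_old)
  also have "(\<Sum>T\<in>?A. f (subword (v @ [c]) (insert ?m T))) = (\<Sum>T\<in>?A. f (subword v T @ [c]))"
    by (intro sum.cong) (auto simp: subword_snoc_new)
  finally show ?thesis .
qed

lemma kappa_snoc:
  "kappa (w @ [c]) = kappa w + (if w \<noteq> [] \<and> last w = c then 0 else 1)"
proof (cases "w = []")
  case False
  let ?K = "\<lambda>w. {i. 1 \<le> i \<and> i \<le> length w - 1 \<and> w ! (i - 1) \<noteq> (w ! i :: letter)}"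
  have "finite (?K w)"
    by simp
  moreover have "?K (w @ [c]) = (if last w = c then ?K w else insert (length w) (?K w))"
  proof -
    have "i \<in> ?K (w @ [c]) \<longleftrightarrow> i \<in> (if last w = c then ?K w else insert (length w) (?K w))" for i
    proof (cases "i = length w")
      case True
      then show ?thesis using False by (cases w) (auto simp: nth_append last_conv_nth)
    next
      case i: False
      show ?thesis
      proof (cases "1 \<le> i \<and> i < length w")
        case True
        then show ?thesis using i by (auto simp: nth_append)
      next
        case False
        then show ?thesis using i by auto
      qed
    qed
    then show ?thesis by blast
  qed
  moreover have "length w \<notin> ?K w"
    using False by (cases w) auto
  ultimately show ?thesis
    using False unfolding kappa_def by simp
qed (simp add: kappa_def)

definition subword_term :: "'a::field \<Rightarrow> xyword \<Rightarrow> 'a" where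
  "subword_term t w = ((t + 1) / t) ^ kappa w * t ^ (length w + 1)"

definition last_term :: "'a::field \<Rightarrow> letter \<Rightarrow> xyword \<Rightarrow> 'a" where
  "last_term t c w = (if w \<noteq> [] \<and> last w = c then subword_term t w else 0)"

text \<open>
  Appending a letter that opens a new run multiplies the term by \<open>((t + 1) / t) * t = t + 1\<close>;
  a letter that continues the last run contributes only the factor \<open>t\<close>. The correction by
  \<open>last_term\<close> unites both cases.
\<close>

lemma subword_term_snoc:
  assumes "t \<noteq> 0"
  shows "subword_term t (w @ [c]) = (t + 1) * subword_term t w - last_term t c w"
  using assms by (auto simp: subword_term_def last_term_def kappa_snoc field_simps)

lemma last_term_snoc:
  "last_term t d (w @ [c]) = (if d = c then subword_term t (w @ [c]) else 0)"
  by (simp add: last_term_def)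

text \<open>
  Write \<open>G v\<close> for the sum over all subwords and \<open>X v c\<close> for the part with subwords ending in \<open>c\<close>.
  Appending \<open>c\<close> turns \<open>G\<close> into \<open>G + (t + 1) * G - X v c\<close>, turns \<open>X v c\<close> into \<open>(t + 1) * G\<close>, and fixes the
  other \<open>X v d\<close>. These are the recursions of \<open>pattern_sum\<close> and of the sums at the
  ends of the interval under the affine correspondence \<open>pattern_sum t v = 1 + G v\<close> and
  \<open>X v c = (t + 1) * (pattern_sum_at t v (target_end c) - 1)\<close>.
\<close>

lemma pattern_sum_eq_subword_sum:
  fixes t :: "'a::field"
  assumes "t \<noteq> 0"
  shows "pattern_sum t v = 1 + (\<Sum>T\<in>Pow {1..length v}. subword_term t (subword v T))"
proof -
  define G where "G v = (\<Sum>T\<in>Pow {1..length v}. subword_term t (subword v T))" for v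
  define X where "X v d = (\<Sum>T\<in>Pow {1..length v}. last_term t d (subword v T))" for v d
  have snoc: "(\<Sum>T\<in>Pow {1..length v}. subword_term t (subword v T @ [c])) = (t + 1) * G v - X v c" for v c
    by (simp add: subword_term_snoc[OF assms] G_def X_def sum_subtractf sum_distrib_left)
  have G: "G (v @ [c]) = G v + ((t + 1) * G v - X v c)" for v c
    unfolding snoc[symmetric] unfolding G_def by (rule sum_subwords_snoc)
  have X: "X (v @ [c]) d = (if d = c then (t + 1) * G v else X v d)" for v c d
    unfolding X_def sum_subwords_snoc using snoc[of v c] by (simp add: last_term_snoc X_def)
  have "pattern_sum t v = 1 + G v \<and> (\<forall>c. X v c = (t + 1) * (pattern_sum_at t v (target_end c) - 1))"
  proof (induction v rule: rev_induct)
    case Nil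
    then show ?case
      using assms
      by (simp add: G_def X_def pattern_sum_Nil pattern_sum_at_Nil_end subword_empty last_term_def
          subword_term_def kappa_def)
  next
    case (snoc c v)
    then show ?case
      by (auto simp: G X pattern_sum_snoc pattern_sum_at_snoc_end pattern_sum_at_snoc_other_end algebra_simps)
  qed
  then show ?thesis
    by (simp add: G_def)
qed

section \<open>Patterns are exactly the equality types of points\<close>

text \<open>
  The condition for membership in the descent polytope, for a sequence indexed by \<open>nat\<close>.
  Sequences, unlike vectors of fixed dimension, can be extended by one more coordinate, which
  makes induction on the word possible.
\<close>

definition ordered_point :: "xyword \<Rightarrow> (nat \<Rightarrow> real) \<Rightarrow> bool" where
  "ordered_point v r \<longleftrightarrow>
     (\<forall>i\<in>{1..length v + 1}. 0 \<le> r i \<and> r i \<le> 1) \<and>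
     (\<forall>i\<in>{1..length v}.
        (v ! (i - 1) = Lx \<longrightarrow> r i \<le> r (i + 1)) \<and>
        (v ! (i - 1) = Ly \<longrightarrow> r i \<ge> r (i + 1)))"

definition position_at :: "(nat \<Rightarrow> real) \<Rightarrow> nat \<Rightarrow> position" where
  "position_at r i =
     (if r i = 0 then AtZero else if r i = 1 then AtOne
      else if 1 < i \<and> r i = r (i - 1) then Repeat else Fresh)"

lemma position_at_iff:
  "position_at r i = AtZero \<longleftrightarrow> r i = 0"
  "position_at r i = AtOne \<longleftrightarrow> r i = 1"
  "position_at r i = Repeat \<longleftrightarrow> r i \<noteq> 0 \<and> r i \<noteq> 1 \<and> 1 < i \<and> r i = r (i - 1)"
  by (simp_all add: position_at_def)

text \<open>
  This is why a pattern loses no information: every equation between neighbours can be read off.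
\<close>

lemma neighbours_equal_iff:
  assumes "i \<ge> 1"
  shows "r i = r (i + 1) \<longleftrightarrow>
    position_at r i = AtZero \<and> position_at r (i + 1) = AtZero \<or>
    position_at r i = AtOne \<and> position_at r (i + 1) = AtOne \<or>
    position_at r (i + 1) = Repeat"
  unfolding position_at_iff using assms by fastforce

definition pattern :: "xyword \<Rightarrow> (nat \<Rightarrow> real) \<Rightarrow> position list" where
  "pattern v r = map (position_at r) [1..<length v + 2]"

lemma pattern_snoc: "pattern (v @ [c]) r = pattern v r @ [position_at r (length v + 2)]"
  by (simp add: pattern_def)

lemma last_pattern: "last (pattern v r) = position_at r (length v + 1)"
  by (simp add: pattern_def)

lemma pattern_cong:
  assumes "\<And>i. i \<in> {1..length v + 1} \<Longrightarrow> r i = r' i"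
  shows "pattern v r = pattern v r'"
  unfolding pattern_def
proof (rule map_cong[OF refl])
  fix i assume "i \<in> set [1..<length v + 2]"
  then have i: "i \<in> {1..length v + 1}" by auto
  then have "r (i - 1) = r' (i - 1)" if "1 < i"
    using that by (intro assms) auto
  then show "position_at r i = position_at r' i"
    using assms[OF i] by (simp add: position_at_def)
qed

lemma ordered_point_snoc_iff:
  "ordered_point (v @ [c]) r \<longleftrightarrow> ordered_point v r \<and> r (length v + 2) \<in> {0..1} \<and>
     (c = Lx \<longrightarrow> r (length v + 1) \<le> r (length v + 2)) \<and>
     (c = Ly \<longrightarrow> r (length v + 1) \<ge> r (length v + 2))"
proof -
  have "{1..length (v @ [c]) + 1} = insert (length v + 2) {1..length v + 1}"
    "{1..length (v @ [c])} = insert (length v + 1) {1..length v}"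
    by auto
  moreover have "(v @ [c]) ! (i - 1) = v ! (i - 1)" if "i \<in> {1..length v}" for i
    using that by (auto simp: nth_append)
  ultimately show ?thesis
    by (auto simp: ordered_point_def)
qed

lemma ordered_point_range:
  "ordered_point v r \<Longrightarrow> i \<in> {1..length v + 1} \<Longrightarrow> r i \<in> {0..1}"
  by (auto simp: ordered_point_def)

lemma admissible_pattern: "ordered_point v r \<Longrightarrow> admissible v (pattern v r)"
proof (induction v rule: rev_induct)
  case Nil
  then show ?case
    by (simp add: pattern_def admissible_def position_at_def)
next
  case (snoc c v)
  then have "r (length v + 1) \<in> {0..1}"
    using ordered_point_snoc_iff ordered_point_range by auto
  with snoc show ?case
    by (cases c) (auto simp: pattern_snoc admissible_snoc_iff last_pattern ordered_point_snoc_iff position_at_def)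
qed

lemma extend_point:
  assumes "ordered_point v r" "step_allowed c (position_at r (length v + 1)) q"
  obtains y where "ordered_point (v @ [c]) (r(length v + 2 := y))"
    "position_at (r(length v + 2 := y)) (length v + 2) = q"
proof -
  let ?l = "r (length v + 1)"
  have l: "?l \<in> {0..1}"
    using assms(1) ordered_point_range by auto
  (* A new interior value halves the distance to the end towards which c moves. *)
  define y where "y = (case q of AtZero \<Rightarrow> 0 | AtOne \<Rightarrow> 1 | Repeat \<Rightarrow> ?l
    | Fresh \<Rightarrow> (case c of Lx \<Rightarrow> (?l + 1) / 2 | Ly \<Rightarrow> ?l / 2))"
  have old: "ordered_point v (r(length v + 2 := y))"
    using assms(1) by (auto simp: ordered_point_def)
  have "ordered_point (v @ [c]) (r(length v + 2 := y))"
    unfolding ordered_point_snoc_iff using old l assms(2)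
    by (cases q; cases c) (auto simp: y_def position_at_def split: if_splits)
  moreover have "position_at (r(length v + 2 := y)) (length v + 2) = q"
    using l assms(2)
    by (cases q; cases c) (auto simp: y_def position_at_def field_simps split: if_splits)
  ultimately show ?thesis
    using that by blast
qed

lemma admissible_is_pattern:
  "admissible v s \<Longrightarrow> \<exists>r. ordered_point v r \<and> pattern v r = s"
proof (induction v arbitrary: s rule: rev_induct)
  case Nil
  then have "s \<in> {[AtZero], [AtOne], [Fresh]}"
    using admissible_Nil_iff by blast
  moreover have "ordered_point [] (\<lambda>_. y) \<and> pattern [] (\<lambda>_. y) = [position_at (\<lambda>_. y) 1]"
    if "y \<in> {0..1}" for y
    using that by (simp add: ordered_point_def pattern_def)
  from this[of 0] this[of 1] this[of "1/2"] calculation show ?case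
    by (auto simp: position_at_def)
next
  case (snoc c v)
  then obtain s' q where s: "s = s' @ [q]"
    by (cases s rule: rev_cases) (auto simp: admissible_def)
  with snoc.prems have "admissible v s'" "step_allowed c (last s') q"
    by (simp_all add: admissible_snoc_iff)
  then obtain r where r: "ordered_point v r" "pattern v r = s'"
    using snoc.IH by blast
  with \<open>step_allowed c (last s') q\<close> have "step_allowed c (position_at r (length v + 1)) q"
    using last_pattern by metis
  then obtain y where y: "ordered_point (v @ [c]) (r(length v + 2 := y))"
    "position_at (r(length v + 2 := y)) (length v + 2) = q"
    using extend_point r(1) by blast
  moreover have "pattern v (r(length v + 2 := y)) = s'"
    unfolding r(2)[symmetric] by (rule pattern_cong) auto
  ultimately show ?case
    unfolding s pattern_snoc by blast
qed

text \<open>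
  Two points lie in the relative interior of the same face exactly when they satisfy the same
  equations among \<open>x\<^sub>i = 0\<close>, \<open>x\<^sub>i = 1\<close> and \<open>x\<^sub>i = x\<^sub>i\<^sub>+\<^sub>1\<close>.
\<close>

definition same_equalities :: "nat \<Rightarrow> (nat \<Rightarrow> real) \<Rightarrow> (nat \<Rightarrow> real) \<Rightarrow> bool" where
  "same_equalities n r r' \<longleftrightarrow>
     (\<forall>i\<in>{1..n + 1}. (r i = 0 \<longleftrightarrow> r' i = 0) \<and> (r i = 1 \<longleftrightarrow> r' i = 1)) \<and>
     (\<forall>i\<in>{1..n}. r i = r (i + 1) \<longleftrightarrow> r' i = r' (i + 1))"

lemma pattern_eq_iff: "pattern v r = pattern v r' \<longleftrightarrow> same_equalities (length v) r r'"
proof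
  assume eq: "pattern v r = pattern v r'"
  have p: "position_at r i = position_at r' i" if "i \<in> {1..length v + 1}" for i
    using eq that by (auto simp: pattern_def simp del: upt_Suc)
  show "same_equalities (length v) r r'"
    unfolding same_equalities_def
  proof (intro conjI ballI)
    fix i assume i: "i \<in> {1..length v}"
    then have "i \<ge> 1" "i \<in> {1..length v + 1}" "i + 1 \<in> {1..length v + 1}" by auto
    then show "r i = r (i + 1) \<longleftrightarrow> r' i = r' (i + 1)"
      by (simp only: neighbours_equal_iff p)
  next
    fix i assume i: "i \<in> {1..length v + 1}"
    show "r i = 0 \<longleftrightarrow> r' i = 0" "r i = 1 \<longleftrightarrow> r' i = 1"
      unfolding position_at_iff[symmetric] p[OF i] by (rule refl)+
  qed
next
  assume same: "same_equalities (length v) r r'"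
  show "pattern v r = pattern v r'"
    unfolding pattern_def
  proof (rule map_cong[OF refl])
    fix i assume "i \<in> set [1..<length v + 2]"
    then have i: "i \<in> {1..length v + 1}" by auto
    have "r i = r (i - 1) \<longleftrightarrow> r' i = r' (i - 1)" if gt: "1 < i"
    proof -
      obtain j where "i = j + 1" "j \<in> {1..length v}"
        using i gt by (cases i) auto
      moreover have "r j = r (j + 1) \<longleftrightarrow> r' j = r' (j + 1)"
        using same \<open>j \<in> _\<close> by (simp add: same_equalities_def)
      ultimately show ?thesis
        by (metis add_diff_cancel_right')
    qed
    moreover have "r i = 0 \<longleftrightarrow> r' i = 0" "r i = 1 \<longleftrightarrow> r' i = 1"
      using i same by (simp_all add: same_equalities_def)
    ultimately show "position_at r i = position_at r' i"
      by (simp add: position_at_def cong: conj_cong)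
  qed
qed

section \<open>The faces of a descent polytope\<close>

definition descent_constraints :: "(nat \<Rightarrow> 'n::finite) \<Rightarrow> xyword \<Rightarrow> ((real ^ 'n) \<times> real) set" where
  "descent_constraints e v =
     (\<lambda>i. (- axis (e i) 1, 0)) ` {1..length v + 1} \<union>
     (\<lambda>i. (axis (e i) 1, 1)) ` {1..length v + 1} \<union>
     (\<lambda>i. (if v ! (i - 1) = Lx then axis (e i) 1 - axis (e (i + 1)) 1
            else axis (e (i + 1)) 1 - axis (e i) 1, 0)) ` {1..length v}"

lemma finite_descent_constraints: "finite (descent_constraints e v)"
  by (simp add: descent_constraints_def)

lemma letter_neq_Lx: "a \<noteq> Lx \<longleftrightarrow> a = Ly"
  by (cases a) auto

lemma descent_polytope_eq_half_spaces:
  "descent_polytope e v = half_spaces (descent_constraints e v)"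
  by (auto simp: descent_polytope_def half_spaces_def descent_constraints_def ball_Un
      inner_axis' inner_diff_left letter_neq_Lx)

abbreviation coords :: "(nat \<Rightarrow> 'n::finite) \<Rightarrow> real ^ 'n \<Rightarrow> nat \<Rightarrow> real" where
  "coords e x \<equiv> \<lambda>i. x $ e i"

lemma descent_polytope_iff: "x \<in> descent_polytope e v \<longleftrightarrow> ordered_point v (coords e x)"
  by (simp add: descent_polytope_def ordered_point_def)

text \<open>
  Reduces statements about the active constraints to statements about coordinates, whichever
  condition \<open>P\<close> is imposed on the active pairs.
\<close>

lemma ball_active_iff:
  "(\<forall>(a, b)\<in>descent_constraints e v. a \<bullet> x = b \<longrightarrow> P a b) \<longleftrightarrow>
     (\<forall>i\<in>{1..length v + 1}. (x $ e i = 0 \<longrightarrow> P (- axis (e i) 1) 0) \<and> (x $ e i = 1 \<longrightarrow> P (axis (e i) 1) 1)) \<and>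
     (\<forall>i\<in>{1..length v}. x $ e i = x $ e (i + 1) \<longrightarrow>
        P (if v ! (i - 1) = Lx then axis (e i) 1 - axis (e (i + 1)) 1
            else axis (e (i + 1)) 1 - axis (e i) 1) 0)"
  by (auto simp: descent_constraints_def ball_Un inner_axis' inner_diff_left)

lemma inner_edge_eq_0_iff:
  fixes y :: "real ^ 'n::finite"
  shows "(if P then axis i 1 - axis j 1 else axis j 1 - axis i 1) \<bullet> y = 0 \<longleftrightarrow> y $ i = y $ j"
  by (auto simp: inner_axis' inner_diff_left)

lemma tight_descent_subset_iff:
  "tight (descent_constraints e v) x \<subseteq> tight (descent_constraints e v) y \<longleftrightarrow>
     (\<forall>i\<in>{1..length v + 1}. (x $ e i = 0 \<longrightarrow> y $ e i = 0) \<and> (x $ e i = 1 \<longrightarrow> y $ e i = 1)) \<and>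
     (\<forall>i\<in>{1..length v}. x $ e i = x $ e (i + 1) \<longrightarrow> y $ e i = y $ e (i + 1))"
  unfolding tight_subset_iff ball_active_iff inner_edge_eq_0_iff by (simp add: inner_axis')

lemma tight_descent_eq_iff:
  "tight (descent_constraints e v) x = tight (descent_constraints e v) y \<longleftrightarrow>
     same_equalities (length v) (coords e x) (coords e y)"
  unfolding set_eq_subset tight_descent_subset_iff same_equalities_def by blast

definition fresh_indices :: "xyword \<Rightarrow> (nat \<Rightarrow> real) \<Rightarrow> nat set" where
  "fresh_indices v r = {i\<in>{1..length v + 1}. position_at r i = Fresh}"

lemma count_pattern: "count_list (pattern v r) Fresh = card (fresh_indices v r)"
proof -
  have "count_list (pattern v r) Fresh = length (filter (\<lambda>i. position_at r i = Fresh) [1..<length v + 2])"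
    by (simp add: pattern_def count_list_eq_length_filter filter_map comp_def eq_commute)
  also have "\<dots> = card (set (filter (\<lambda>i. position_at r i = Fresh) [1..<length v + 2]))"
    by (simp only: distinct_card[OF distinct_filter[OF distinct_upt]])
  also have "set (filter (\<lambda>i. position_at r i = Fresh) [1..<length v + 2]) = fresh_indices v r"
    by (auto simp: fresh_indices_def simp del: upt_Suc)
  finally show ?thesis .
qed

lemma dim_vanishing_coordinates:
  fixes J :: "'n::finite set"
  shows "dim {d :: real ^ 'n. \<forall>k. k \<notin> J \<longrightarrow> d $ k = 0} = card J"
proof -
  let ?b = "\<lambda>k::'n. axis k (1::real)"
  have "{d :: real ^ 'n. \<forall>k. k \<notin> J \<longrightarrow> d $ k = 0} = {d. \<forall>b\<in>Basis. b \<notin> ?b ` J \<longrightarrow> d \<bullet> b = 0}"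
    by (auto simp: Basis_vec_def inner_axis axis_eq_axis)
  also have "dim \<dots> = card (?b ` J)"
    by (rule dim_substandard) (auto simp: Basis_vec_def)
  also have "\<dots> = card J"
    by (intro card_image) (auto simp: inj_on_def axis_eq_axis)
  finally show ?thesis .
qed

text \<open>
  The map \<open>\<theta>\<close> subtracts from each \<open>Repeat\<close> coordinate the coordinate before it. It is unitriangular, hence
  bijective, and it turns the equations of the space (\<open>d\<^sub>i = 0\<close> at a bound, \<open>d\<^sub>i = d\<^sub>i\<^sub>-\<^sub>1\<close> at a
  repetition) into the vanishing of all coordinates that are not \<open>Fresh\<close>.
\<close>

lemma dim_active_directions:
  fixes e :: "nat \<Rightarrow> 'n::finite"
  assumes e: "bij_betw e {1..length v + 1} UNIV"
  shows "dim {d :: real ^ 'n. (\<forall>i\<in>{1..length v + 1}. x $ e i = 0 \<or> x $ e i = 1 \<longrightarrow> d $ e i = 0) \<and>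
      (\<forall>i\<in>{1..length v}. x $ e i = x $ e (i + 1) \<longrightarrow> d $ e i = d $ e (i + 1))} =
    card (fresh_indices v (coords e x))" (is "dim ?D = card ?J")
proof -
  let ?I = "{1..length v + 1}" and ?p = "position_at (coords e x)"
  define num where "num = inv_into ?I e"
  have num: "num (e i) = i" if "i \<in> ?I" for i
    using e that by (auto simp: num_def bij_betw_def)
  have all: "(\<forall>k. P k) \<longleftrightarrow> (\<forall>i\<in>?I. P (e i))" for P
    using e by (auto simp: bij_betw_def) (metis imageE UNIV_I)
  define \<theta> where "\<theta> d = (\<chi> k. d $ k - (if ?p (num k) = Repeat then d $ e (num k - 1) else 0))"
    for d :: "real ^ 'n"
  have \<theta>: "\<theta> d $ e i = d $ e i - (if ?p i = Repeat then d $ e (i - 1) else 0)" if "i \<in> ?I" for d i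
    using num[OF that] by (simp add: \<theta>_def)
  have lin: "linear \<theta>"
    by (rule linearI) (auto simp: \<theta>_def vec_eq_iff algebra_simps)
  have "inj \<theta>"
  proof (subst linear_injective_0[OF lin], intro allI impI)
    fix d assume "\<theta> d = 0"
    then have z: "d $ e i = (if ?p i = Repeat then d $ e (i - 1) else 0)" if "i \<in> ?I" for i
      using \<theta>[OF that, of d] by simp
    have "i \<in> ?I \<longrightarrow> d $ e i = 0" for i
    proof (induction i rule: less_induct)
      case (less i)
      have "i - 1 < i \<and> i - 1 \<in> ?I" if "i \<in> ?I" "?p i = Repeat"
        using that unfolding position_at_iff by auto
      then show ?case
        using less[of "i - 1"] z[of i] by auto
    qed
    then show "d = 0"
      unfolding vec_eq_iff all by simp
  qed
  have "surj \<theta>"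
    using linear_injective_imp_surjective[OF lin \<open>inj \<theta>\<close>] by simp
  have D: "?D = {d. \<forall>i\<in>?I. ?p i \<noteq> Fresh \<longrightarrow> \<theta> d $ e i = 0}"
  proof (intro equalityI subsetI)
    fix d assume d: "d \<in> ?D"
    show "d \<in> {d. \<forall>i\<in>?I. ?p i \<noteq> Fresh \<longrightarrow> \<theta> d $ e i = 0}"
    proof (intro CollectI ballI impI)
      fix i assume i: "i \<in> ?I" "?p i \<noteq> Fresh"
      show "\<theta> d $ e i = 0"
      proof (cases "?p i")
        case Repeat
        then have r: "1 < i" "x $ e (i - 1) = x $ e i"
          unfolding position_at_iff by auto
        with i(1) have "i - 1 \<in> {1..length v}" "i - 1 + 1 = i"
          by auto
        with r(2) d have "d $ e (i - 1) = d $ e i"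
          by (metis (mono_tags, lifting) mem_Collect_eq)
        with i(1) Repeat show ?thesis
          by (simp add: \<theta>)
      next
        case AtZero
        then have "x $ e i = 0"
          unfolding position_at_iff .
        with d i(1) have "d $ e i = 0"
          by blast
        with i(1) AtZero show ?thesis
          by (simp add: \<theta>)
      next
        case AtOne
        then have "x $ e i = 1"
          unfolding position_at_iff .
        with d i(1) have "d $ e i = 0"
          by blast
        with i(1) AtOne show ?thesis
          by (simp add: \<theta>)
      qed (use i in simp)
    qed
  next
    fix d assume "d \<in> {d. \<forall>i\<in>?I. ?p i \<noteq> Fresh \<longrightarrow> \<theta> d $ e i = 0}"
    then have z: "d $ e i = (if ?p i = Repeat then d $ e (i - 1) else 0)" if "i \<in> ?I" "?p i \<noteq> Fresh" for i
      using that \<theta>[of i d] by simp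
    have zero: "d $ e i = 0" if "i \<in> ?I" "x $ e i = 0 \<or> x $ e i = 1" for i
    proof -
      have "?p i = AtZero \<or> ?p i = AtOne"
        using that(2) unfolding position_at_iff .
      then show ?thesis
        using z[OF that(1)] by auto
    qed
    moreover have "d $ e i = d $ e (i + 1)" if i: "i \<in> {1..length v}" and eq: "x $ e i = x $ e (i + 1)" for i
    proof (cases "x $ e i = 0 \<or> x $ e i = 1")
      case True
      then show ?thesis
        using zero[of i] zero[of "i + 1"] i eq by auto
    next
      case False
      then have "?p (i + 1) = Repeat"
        using i eq by (auto simp: position_at_def)
      then show ?thesis
        using z[of "i + 1"] i by auto
    qed
    ultimately show "d \<in> ?D"
      using zero by blast
  qed
  have "\<theta> ` ?D = {d. \<forall>i\<in>?I. ?p i \<noteq> Fresh \<longrightarrow> d $ e i = 0}"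
    unfolding D using \<open>surj \<theta>\<close> by (auto simp: image_iff surj_def)
  also have "\<dots> = {d. \<forall>k. k \<notin> e ` ?J \<longrightarrow> d $ k = 0}"
  proof -
    have "e i \<in> e ` ?J \<longleftrightarrow> i \<in> ?J" if "i \<in> ?I" for i
      using e that by (intro inj_on_image_mem_iff[of e ?I]) (auto simp: bij_betw_def fresh_indices_def)
    then have "e i \<in> e ` ?J \<longleftrightarrow> ?p i = Fresh" if "i \<in> ?I" for i
      using that by (simp add: fresh_indices_def)
    then show ?thesis
      unfolding all by auto
  qed
  finally have "dim (\<theta> ` ?D) = card (e ` ?J)"
    by (simp only: dim_vanishing_coordinates)
  also have "\<dots> = card ?J"
    using e by (intro card_image) (auto simp: bij_betw_def inj_on_def fresh_indices_def)
  also have "dim (\<theta> ` ?D) = dim ?D"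
    by (rule dim_image_eq[OF lin]) (use \<open>inj \<theta>\<close> in \<open>auto intro: inj_on_subset\<close>)
  finally show ?thesis .
qed

lemma aff_dim_descent_face:
  assumes "bij_betw e {1..length v + 1} UNIV" "x \<in> descent_polytope e v"
  shows "aff_dim (tight_face (descent_constraints e v) x) = int (count_list (pattern v (coords e x)) Fresh)"
proof -
  have "{d. \<forall>(a, b)\<in>descent_constraints e v. a \<bullet> x = b \<longrightarrow> a \<bullet> d = 0} =
      {d. (\<forall>i\<in>{1..length v + 1}. x $ e i = 0 \<or> x $ e i = 1 \<longrightarrow> d $ e i = 0) \<and>
        (\<forall>i\<in>{1..length v}. x $ e i = x $ e (i + 1) \<longrightarrow> d $ e i = d $ e (i + 1))}"
    unfolding ball_active_iff inner_edge_eq_0_iff by (auto simp: inner_axis')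
  then show ?thesis
    using aff_dim_tight_face[OF finite_descent_constraints, of x e v] assms(2)
    by (simp only: count_pattern dim_active_directions[OF assms(1)] descent_polytope_eq_half_spaces)
qed

text \<open>
  Choosing a point for each pattern and forming its face gives a bijection from the
  admissible patterns to the nonempty faces.
\<close>

lemma f_polynomial_descent_polytope:
  assumes e: "bij_betw e {1..length v + 1} (UNIV :: 'n::finite set)"
  shows "f_polynomial (descent_polytope e v) = (\<Sum>s | admissible v s. monom 1 (count_list s Fresh))"
proof -
  let ?C = "descent_constraints e v" and ?P = "descent_polytope e v"
  let ?pat = "\<lambda>x. pattern v (coords e x)"
  have pat: "?pat ` ?P = {s. admissible v s}"
  proof (intro equalityI subsetI)
    fix s assume "s \<in> {s. admissible v s}"
    then obtain r where r: "ordered_point v r" "pattern v r = s"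
      using admissible_is_pattern by blast
    define x where "x = (\<chi> k. r (inv_into {1..length v + 1} e k))"
    have x: "coords e x i = r i" if "i \<in> {1..length v + 1}" for i
      using e that by (simp add: x_def bij_betw_def)
    then have "ordered_point v (coords e x)"
      using r(1) by (auto simp: ordered_point_def)
    moreover have "?pat x = s"
      using r(2) pattern_cong[OF x] by simp
    ultimately show "s \<in> ?pat ` ?P"
      by (auto simp: descent_polytope_iff)
  qed (auto simp: descent_polytope_iff admissible_pattern)
  have face_eq: "tight_face ?C x = tight_face ?C y \<longleftrightarrow> ?pat x = ?pat y" if "x \<in> ?P" "y \<in> ?P" for x y
    using that by (simp add: tight_face_eq_iff descent_polytope_eq_half_spaces tight_descent_eq_iff pattern_eq_iff)
  define pt where "pt = inv_into ?P ?pat"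
  have pt: "pt s \<in> ?P" "?pat (pt s) = s" if "admissible v s" for s
    using that pat by (auto simp: pt_def intro!: inv_into_into f_inv_into_f)
  have "bij_betw (\<lambda>s. tight_face ?C (pt s)) {s. admissible v s} (tight_face ?C ` ?P)"
    unfolding bij_betw_def
  proof (intro conjI equalityI subsetI)
    show "inj_on (\<lambda>s. tight_face ?C (pt s)) {s. admissible v s}"
      by (rule inj_onI) (use face_eq pt in \<open>metis mem_Collect_eq\<close>)
  next
    fix F assume "F \<in> tight_face ?C ` ?P"
    then obtain x where x: "x \<in> ?P" "F = tight_face ?C x" by blast
    then have "admissible v (?pat x)"
      using pat by blast
    then have "F = tight_face ?C (pt (?pat x))"
      using x pt face_eq by simp
    then show "F \<in> (\<lambda>s. tight_face ?C (pt s)) ` {s. admissible v s}"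
      using \<open>admissible v (?pat x)\<close> by blast
  qed (use pt in auto)
  then have "(\<Sum>F\<in>tight_face ?C ` ?P. monom (1::int) (nat (aff_dim F))) =
      (\<Sum>s | admissible v s. monom 1 (nat (aff_dim (tight_face ?C (pt s)))))"
    by (rule sum.reindex_bij_betw[symmetric])
  also have "\<dots> = (\<Sum>s | admissible v s. monom 1 (count_list s Fresh))"
    by (intro sum.cong) (simp_all add: aff_dim_descent_face[OF e] pt)
  finally show ?thesis
    unfolding f_polynomial_def descent_polytope_eq_half_spaces
      nonempty_faces_eq[OF finite_descent_constraints]
    by simp
qed

section \<open>The f-polynomial\<close>

lemma to_fract_monom: "to_fract (monom 1 k :: int poly) = indet ^ k"
proof -
  have "to_fract ([:0, 1:] ^ k :: int poly) = indet ^ k"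
    by (induction k) (simp_all only: power_0 power_Suc to_fract_1 to_fract_mult)
  then show ?thesis
    by (simp add: monom_altdef)
qed

theorem theorem2p2:
  fixes n :: nat and v :: xyword and e :: "nat \<Rightarrow> 'n::finite"
  assumes "n \<ge> 1"
    and "length v = n - 1"
    and "CARD('n) = n"
    and "bij_betw e {1..n} (UNIV :: 'n set)"
  shows "to_fract (f_polynomial (descent_polytope e v)) =
    1 + (\<Sum>T\<in>Pow {1..n - 1}.
           ((indet + 1) / indet) ^ kappa (subword v T) * indet ^ (card T + 1))"
proof -
  have n: "n = length v + 1"
    using assms by simp
  have "to_fract (f_polynomial (descent_polytope e v)) = pattern_sum indet v"
    using f_polynomial_descent_polytope[of e v] assms(4)
    by (simp add: n pattern_sum_def to_fract_monom)
  also have "\<dots> = 1 + (\<Sum>T\<in>Pow {1..length v}. subword_term indet (subword v T))"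
    by (rule pattern_sum_eq_subword_sum) simp
  finally show ?thesis
    by (simp add: n subword_term_def length_subword)
qed

end
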